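(* Let $1\leqslant p<\infty$ and $f\in H^p$. For every integer $n\geqslant 0$, $$\sum_{m=-\infty}^{+\infty}|f(m+i(n+1))|^p\leqslant\sum_{m=-\infty}^{+\infty}|f(m+in)|^p.$$ Hence $$\|f\|_{H^p}=\Big(\sum_{m=-\infty}^{+\infty}|f(m)|^p\Big)^{1/p}.$$
   Context: Lattice points $(m,n)\in\mathbb Z^2$ are identified with $m+in\in\mathbb C$. Let $\mathbb Z^2_+=\{m+in: m,n\in\mathbb Z,\ n\geqslant 0\}$. A function $f:\mathbb Z^2_+\to\mathbb C$ is discrete holomorphic, written $f\in\operatorname{Hol}(\mathbb Z^2_+)$, if $f(z)+i f(z+1)-f(z+1+i)-i f(z+i)=0$ for every $z\in\mathbb Z^2_+$. For $1\leqslant p\leqslant\infty$, $H^p=H^p(\mathbb Z^2_+)=\{f\in\operatorname{Hol}(\mathbb Z^2_+): \|f\|_{H^p}:=\sup_{n\geqslant 0}\|f(\cdot+in)\|_{\ell^p(\mathbb Z)}<\infty\}$. *)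

theory Defs
  imports "HOL-Analysis.Analysis"
begin

definition lattice_pt :: "int \<Rightarrow> nat \<Rightarrow> complex"
  where "lattice_pt m n = of_int m + \<i> * of_nat n"

definition Z2_plus :: "complex set"
  where "Z2_plus = {lattice_pt m n | m n. True}"

text \<open>A function on the lattice half-plane is represented by a function on all of the complex
  plane. Every notion below only inspects its values at points of \<^const>\<open>Z2_plus\<close>.\<close>

definition Hol :: "(complex \<Rightarrow> complex) set"
  where "Hol = {f. \<forall>z \<in> Z2_plus. f z + \<i> * f (z + 1) - f (z + 1 + \<i>) - \<i> * f (z + \<i>) = 0}"

definition row :: "(complex \<Rightarrow> complex) \<Rightarrow> nat \<Rightarrow> int \<Rightarrow> complex"
  where "row f n = (\<lambda>m. f (lattice_pt m n))"

text \<open>The exponent is finite and the norms are real valued. As \<^const>\<open>infsum\<close> is 0 when the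
  series diverges, \<open>ell_norm p u\<close> is meaningful only for \<open>u \<in> ell p\<close>.\<close>

definition ell :: "real \<Rightarrow> (int \<Rightarrow> complex) set"
  where "ell p = {u. (\<lambda>m. cmod (u m) powr p) summable_on UNIV}"

definition ell_norm :: "real \<Rightarrow> (int \<Rightarrow> complex) \<Rightarrow> real"
  where "ell_norm p u = (\<Sum>\<^sub>\<infinity>m. cmod (u m) powr p) powr (1 / p)"

text \<open>Finiteness of the supremum of the extended-real row norms is spelled out as: every row
  norm is finite, and the row norms are bounded above.\<close>

definition Hp :: "real \<Rightarrow> (complex \<Rightarrow> complex) set"
  where "Hp p = {f \<in> Hol. (\<forall>n. row f n \<in> ell p) \<and> bdd_above (range (\<lambda>n. ell_norm p (row f n)))}"

definition Hp_norm :: "real \<Rightarrow> (complex \<Rightarrow> complex) \<Rightarrow> real"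
  where "Hp_norm p f = (SUP n. ell_norm p (row f n))"

end

theory Submission
  imports Defs
begin

text \<open>Discrete holomorphy forces \<open>4 f(z)\<close> to be the sum of \<open>f\<close> over the four diagonal neighbours of
  \<open>z\<close>. As \<open>t \<mapsto> t\<^sup>p\<close> is convex, the \<open>p\<close>-th power sum of a row is then at most the average of those
  of the rows above and below it. A bounded sequence that is convex in this sense is decreasing.\<close>

text \<open>Convexity makes the increments nondecreasing. A single positive increment
  \<open>d\<close> would therefore recur, at least as large, at every later step and force linear
  growth past any bound.\<close>

lemma bounded_convex_seq_decreasing:
  fixes a :: "nat \<Rightarrow> real"
  assumes convex: "\<And>n. 2 * a (Suc n) \<le> a n + a (Suc (Suc n))"
    and bdd: "bdd_above (range a)"
  shows "decseq a"
proof (rule decseq_SucI, rule ccontr)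
  fix n
  define d where "d = a (Suc n) - a n"
  assume "\<not> a (Suc n) \<le> a n"
  then have "d > 0" by (simp add: d_def)
  have step: "d \<le> a (Suc (n + k)) - a (n + k)" for k
  proof (induction k)
    case (Suc k)
    then show ?case using convex [of "n + k"] by simp
  qed (simp add: d_def)
  have growth: "a n + real k * d \<le> a (n + k)" for k
  proof (induction k)
    case (Suc k)
    then show ?case using step [of k] by (simp add: algebra_simps)
  qed simp
  obtain B where B: "\<And>k. a k \<le> B" using bdd by (auto simp: bdd_above_def)
  obtain k where "B - a n < real k * d" using reals_Archimedean3 [OF \<open>d > 0\<close>] by blast
  then show False using growth [of k] B [of "n + k"] by simp
qed

lemma lattice_pt_in_Z2_plus: "lattice_pt m n \<in> Z2_plus"
  by (auto simp: Z2_plus_def)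

lemma Hol_square:
  assumes "f \<in> Hol"
  shows "row f n m + \<i> * row f n (m + 1) - row f (Suc n) (m + 1) - \<i> * row f (Suc n) m = 0"
proof -
  have "lattice_pt m n + 1 = lattice_pt (m + 1) n"
    "lattice_pt (m + 1) n + \<i> = lattice_pt (m + 1) (Suc n)"
    "lattice_pt m n + \<i> = lattice_pt m (Suc n)"
    by (simp_all add: lattice_pt_def algebra_simps)
  then show ?thesis
    using assms lattice_pt_in_Z2_plus [of m n] by (auto simp: Hol_def row_def)
qed

text \<open>The point \<open>lattice_pt m (Suc n)\<close> is a corner of four unit squares. Scale
  the relation of each square so that this corner has coefficient 1: the opposite corners then get
  coefficient -1, and in the sum each horizontal or vertical neighbour, shared by two squares,
  cancels.\<close>

lemma Hol_diagonal_mean_value: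
  assumes "f \<in> Hol"
  shows "4 * row f (Suc n) m = row f n (m - 1) + row f n (m + 1)
    + row f (Suc (Suc n)) (m - 1) + row f (Suc (Suc n)) (m + 1)"
  using Hol_square [OF assms, of n m] Hol_square [OF assms, of n "m - 1"]
    Hol_square [OF assms, of "Suc n" m] Hol_square [OF assms, of "Suc n" "m - 1"]
  by (simp add: complex_eq_iff)

lemma powr_mean2:
  fixes x y p :: real
  assumes "1 \<le> p" "0 \<le> x" "0 \<le> y"
  shows "((x + y) / 2) powr p \<le> (x powr p + y powr p) / 2"
proof (cases "x = 0 \<or> y = 0")
  case True
  \<comment> \<open>If one argument vanishes, the claim is (t/2)^p \<le> t^p/2, which rests on this
    bound. Convexity is then invoked at positive points only.\<close>
  have "(1 / 2 :: real) powr p \<le> 1 / 2"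
    using powr_mono' [of 1 p "1/2 :: real"] assms(1) by simp
  then have "(t / 2) powr p \<le> t powr p / 2" if "0 \<le> t" for t :: real
    using that mult_left_mono [of "(1/2) powr p" "1/2" "t powr p"] powr_mult [of t "1/2" p] by simp
  then show ?thesis using True assms by auto
next
  case False
  then show ?thesis
    using convex_onD [OF powr_convex [OF assms(1)], of "1/2" x y] assms
    by (simp add: field_simps)
qed

lemma norm_mean4_powr:
  fixes x y z w :: "'a::real_normed_vector" and p :: real
  assumes "1 \<le> p" and "4 *\<^sub>R v = x + y + z + w"
  shows "norm v powr p \<le> (norm x powr p + norm y powr p + norm z powr p + norm w powr p) / 4"
proof -
  have "4 * norm v = norm (x + y + z + w)" using assms(2) by (metis norm_scaleR abs_numeral)
  also have "\<dots> \<le> norm x + norm y + norm z + norm w"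
    by (intro order.trans [OF norm_triangle_ineq] add_right_mono order.refl)
  \<comment> \<open>The mean of four is nested as a mean of two means, so that
    \<open>powr_mean2\<close> applies on each level.\<close>
  finally have "norm v \<le> ((norm x + norm y) / 2 + (norm z + norm w) / 2) / 2"
    by (simp add: field_simps)
  then have "norm v powr p \<le> (((norm x + norm y) / 2 + (norm z + norm w) / 2) / 2) powr p"
    using assms(1) by (intro powr_mono2) auto
  also have "\<dots> \<le> (((norm x + norm y) / 2) powr p + ((norm z + norm w) / 2) powr p) / 2"
    using assms(1) by (intro powr_mean2) auto
  also have "\<dots> \<le> ((norm x powr p + norm y powr p) / 2 + (norm z powr p + norm w powr p) / 2) / 2"
    using assms(1) by (intro divide_right_mono add_mono powr_mean2) auto
  finally show ?thesis by (simp add: field_simps)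
qed

lemma has_sum_shift_int:
  fixes g :: "int \<Rightarrow> 'a::{comm_monoid_add, topological_space}"
  assumes "(g has_sum s) UNIV"
  shows "((\<lambda>m. g (m + k)) has_sum s) UNIV"
proof -
  have "bij_betw (\<lambda>m::int. m + k) UNIV UNIV"
    by (rule bij_betwI [where g = "\<lambda>m. m - k"]) auto
  from has_sum_reindex_bij_betw [OF this] assms show ?thesis by blast
qed

text \<open>The root in \<open>ell_norm\<close> is left out because the pointwise convexity bound
  can be summed along a row only in terms of p-th powers.\<close>

definition row_power_sum :: "real \<Rightarrow> (complex \<Rightarrow> complex) \<Rightarrow> nat \<Rightarrow> real"
  where "row_power_sum p f n = (\<Sum>\<^sub>\<infinity>m. cmod (row f n m) powr p)"

lemma row_power_sum_nonneg: "0 \<le> row_power_sum p f n"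
  unfolding row_power_sum_def by (rule infsum_nonneg) simp

lemma row_power_sum_convex:
  assumes "1 \<le> p" "f \<in> Hol" and summable: "\<And>n. row f n \<in> ell p"
  shows "2 * row_power_sum p f (Suc n) \<le> row_power_sum p f n + row_power_sum p f (Suc (Suc n))"
proof -
  define g where "g n m = cmod (row f n m) powr p" for n m
  let ?N = "row_power_sum p f"
  \<comment> \<open>Membership in \<open>ell p\<close> guarantees genuine sums here, excluding the
    default value 0 of a divergent \<open>infsum\<close>.\<close>
  have g: "(g k has_sum ?N k) UNIV" for k
    using summable [of k] by (simp add: ell_def g_def [abs_def] row_power_sum_def)
  \<comment> \<open>The left shift is written \<open>m + - 1\<close> to fit the form
    \<open>m + k\<close> in \<open>has_sum_shift_int\<close>. Shifts preserve sums over the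
    integers, so each adjacent row contributes its power sum twice.\<close>
  let ?h = "\<lambda>m. g n (m + - 1) + g n (m + 1) + g (Suc (Suc n)) (m + - 1) + g (Suc (Suc n)) (m + 1)"
  have sum_h: "(?h has_sum (?N n + ?N n + ?N (Suc (Suc n)) + ?N (Suc (Suc n)))) UNIV"
    by (intro has_sum_add has_sum_shift_int g)
  have sum_4g: "((\<lambda>m. 4 * g (Suc n) m) has_sum (4 * ?N (Suc n))) UNIV"
    by (intro has_sum_cmult_right g)
  have "4 * g (Suc n) m \<le> ?h m" for m
    using norm_mean4_powr [OF \<open>1 \<le> p\<close>, of "row f (Suc n) m"]
      Hol_diagonal_mean_value [OF \<open>f \<in> Hol\<close>, of n m]
    by (fastforce simp: g_def scaleR_conv_of_real)
  then have "4 * ?N (Suc n) \<le> ?N n + ?N n + ?N (Suc (Suc n)) + ?N (Suc (Suc n))"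
    using has_sum_mono [OF sum_4g sum_h] by blast
  then show ?thesis by simp
qed

lemma row_power_sum_decseq:
  assumes "1 \<le> p" "f \<in> Hp p"
  shows "decseq (row_power_sum p f)"
proof (rule bounded_convex_seq_decreasing)
  show "2 * row_power_sum p f (Suc n) \<le> row_power_sum p f n + row_power_sum p f (Suc (Suc n))" for n
    using assms by (intro row_power_sum_convex) (auto simp: Hp_def)
  obtain B where B: "\<And>n. ell_norm p (row f n) \<le> B"
    using assms(2) by (auto simp: Hp_def bdd_above_def)
  have "row_power_sum p f n \<le> B powr p" for n
  proof -
    have "row_power_sum p f n = ell_norm p (row f n) powr p"
      using assms(1) row_power_sum_nonneg [of p f n]
      by (simp add: ell_norm_def row_power_sum_def powr_powr)
    also have "\<dots> \<le> B powr p"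
      using assms(1) B [of n] by (intro powr_mono2) (auto simp: ell_norm_def)
    finally show ?thesis .
  qed
  then show "bdd_above (range (row_power_sum p f))" by (auto simp: bdd_above_def)
qed

theorem proposition3p7:
  fixes p :: real and f :: "complex \<Rightarrow> complex"
  assumes "1 \<le> p" and "f \<in> Hp p"
  shows "(\<forall>n::nat. (\<Sum>\<^sub>\<infinity>m::int. cmod (f (lattice_pt m (n + 1))) powr p)
                   \<le> (\<Sum>\<^sub>\<infinity>m::int. cmod (f (lattice_pt m n)) powr p))
         \<and> Hp_norm p f = (\<Sum>\<^sub>\<infinity>m::int. cmod (f (of_int m)) powr p) powr (1 / p)"
proof
  note dec = row_power_sum_decseq [OF assms]
  show "\<forall>n::nat. (\<Sum>\<^sub>\<infinity>m::int. cmod (f (lattice_pt m (n + 1))) powr p)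
                   \<le> (\<Sum>\<^sub>\<infinity>m::int. cmod (f (lattice_pt m n)) powr p)"
    using decseq_SucD [OF dec] by (simp add: row_power_sum_def row_def)
  have norm_eq: "ell_norm p (row f n) = row_power_sum p f n powr (1 / p)" for n
    by (simp add: ell_norm_def row_power_sum_def)
  \<comment> \<open>The supremum defining \<open>Hp_norm\<close> is attained at row 0, which is the
    real axis.\<close>
  have "ell_norm p (row f n) \<le> ell_norm p (row f 0)" for n
    unfolding norm_eq using assms(1) row_power_sum_nonneg decseqD [OF dec, of 0 n]
    by (intro powr_mono2) auto
  then have "Hp_norm p f = ell_norm p (row f 0)"
    unfolding Hp_norm_def by (intro cSup_eq_maximum) auto
  then show "Hp_norm p f = (\<Sum>\<^sub>\<infinity>m::int. cmod (f (of_int m)) powr p) powr (1 / p)"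
    by (simp add: ell_norm_def row_def lattice_pt_def)
qed

end
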